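(* (Static Gradual Guarantee.) Let $\Gamma,\Gamma'$ be typing contexts, let $M,M'$ be terms of the Gradually Typed Lambda Calculus (GTLC), and let $A'$ be a type. Suppose $\Gamma'\vdash_G M':A'$. If $\Gamma\sqsubseteq^{*}\Gamma'$ and $M\sqsubseteq^{G}M'$, then there exists a type $A$ such that $\Gamma\vdash_G M:A$ and $A\sqsubseteq A'$.
   Context: **Types.** Base types $b$ are $\mathtt{Nat},\mathtt{Bool},\mathtt{Int},\mathtt{Unit},\bot$. Types: $A,B,C::=b\mid\,?\mid A\to B\mid A\times B\mid A+B$, where $?$ is the unknown type. Typing contexts are finite sequences of types: $\Gamma::=\emptyset\mid\Gamma\cdot A$. Variables are de Bruijn indices: $0$ has type $A$ in $\Gamma\cdot A$, and $x+1$ has type $A$ in $\Gamma\cdot B$ if $x$ has type $A$ in $\Gamma$. Primitive types: $P::=b\mid b\to P$. Each base type denotes a set $[\![b]\!]$ (naturals, Booleans, integers, one-element set, empty set respectively) and $[\![b\to P]\!]$ is the set of functions $[\![b]\!]\to[\![P]\!]$. A constant of primitive type $P$ is an element $k\in[\![P]\!]$ (together with $P$). Blame labels $\ell$ range over a fixed set. **Consistency** $\sim$ is the relation on types generated by: $A\sim\,?$; $?\sim B$; $b\sim b$; if $A\sim A'$ and $B\sim B'$ then $A\otimes B\sim A'\otimes B'$ for $\otimes\in\{\to,\times,+\}$ (it is symmetric). **Join** of consistent types: $A\sqcup\,?=A$, $?\sqcup B=B$, $b\sqcup b=b$, $(A\otimes B)\sqcup(A'\otimes B')=(A\sqcup A')\otimes(B\sqcup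 B')$. **Matching** $A\triangleright A_1\otimes A_2$ holds iff $A=A_1\otimes A_2$, or $A=\,?$ and $A_1=A_2=\,?$. **GTLC terms:** $\$k$, $`x$, $\lambda[A]\,M$, $(L\,M)_\ell$, $\mathtt{if}_\ell\,L\,M\,N$, $\mathtt{cons}\,M\,N$, $\pi_i^\ell M$ ($i\in\{1,2\}$), $\mathtt{inl}[B]\,M$, $\mathtt{inr}[A]\,M$, $\mathtt{case}_\ell[B_1,C_1]\,L\,M\,N$ (binding one variable in $M$ and one in $N$). **Typing** $\Gamma\vdash_G M:A$: - $\Gamma\vdash_G\$k:P$ if $k\in[\![P]\!]$; $\Gamma\vdash_G`x:A$ if $x$ has type $A$ in $\Gamma$. - $\Gamma\vdash_G\lambda[A]M:A\to B$ if $\Gamma\cdot A\vdash_G M:B$. - $\Gamma\vdash_G(L\,M)_\ell:A_2$ if $\Gamma\vdash_G L:A$, $\Gamma\vdash_G M:B$, $A\triangleright A_1\to A_2$, $A_1\sim B$. - $\Gamma\vdash_G\mathtt{if}_\ell\,L\,M\,N:B\sqcup C$ if $L:A$, $M:B$, $N:C$ in $\Gamma$, $A\sim\mathtt{Bool}$, $B\sim C$. - $\Gamma\vdash_G\mathtt{cons}\,M\,N:A\times B$ if $M:A$, $N:B$; $\Gamma\vdash_G\pi_i^\ell M:A_i$ if $M:A$ and $A\triangleright A_1\times A_2$. - $\mathtt{inl}[B]M:A+B$ if $M:A$; $\mathtt{inr}[A]M:A+B$ if $M:B$. - $\Gamma\vdash_G\mathtt{case}_\ell[B_1,C_1]\,L\,M\,N:B_2\sqcup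 C_2$ if $\Gamma\vdash_G L:A$, $\Gamma\cdot B_1\vdash_G M:B_2$, $\Gamma\cdot C_1\vdash_G N:C_2$, $A\sim(B_1+C_1)$, $B_2\sim C_2$. **Type precision** $\sqsubseteq$: $?\sqsubseteq A$; $b\sqsubseteq b$; if $A\sqsubseteq A'$ and $B\sqsubseteq B'$ then $A\otimes B\sqsubseteq A'\otimes B'$ for $\otimes\in\{\to,\times,+\}$. **Context precision** $\sqsubseteq^{*}$: $\emptyset\sqsubseteq^{*}\emptyset$; $\Gamma\cdot A\sqsubseteq^{*}\Gamma'\cdot A'$ if $A\sqsubseteq A'$ and $\Gamma\sqsubseteq^{*}\Gamma'$. **Term precision** $M\sqsubseteq^G M'$: $\$k\sqsubseteq^G\$k$; $`x\sqsubseteq^G`x$; otherwise both terms have the same outermost term constructor (blame labels may differ), corresponding subterms are related by $\sqsubseteq^G$, and corresponding type annotations (the $[A]$ of $\lambda[A]$, $[B]$ of $\mathtt{inl}[B]$, $[A]$ of $\mathtt{inr}[A]$, and both $B_1,C_1$ of $\mathtt{case}[B_1,C_1]$) are related by $\sqsubseteq$. *)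

theory Defs
  imports Main "HOL-Library.FuncSet"
begin

section \<open>Types\<close>

datatype base = NatB | BoolB | IntB | UnitB | VoidB

datatype ty =
    Base base
  | Unknown  (\<open>\<star>\<close>)
  | Fun ty ty  (infixr \<open>\<rightarrow>\<^sub>t\<close> 65)
  | Prod ty ty  (infixr \<open>\<times>\<^sub>t\<close> 75)
  | Sum ty ty  (infixr \<open>+\<^sub>t\<close> 70)

datatype prim = PBase base | PFun base prim

fun prim_ty :: "prim \<Rightarrow> ty" where
  "prim_ty (PBase b) = Base b"
| "prim_ty (PFun b P) = Base b \<rightarrow>\<^sub>t prim_ty P"

section \<open>Constants\<close>

text \<open>
  The denotations of all primitive types are subsets of the single type \<open>val\<close>. A function
  from \<open>base_den b\<close> to \<open>prim_den P\<close> is a HOL function in the extensional function space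
  \<open>\<rightarrow>\<^sub>E\<close>, so that two functions agreeing on \<open>base_den b\<close> are equal. In particular
  \<open>prim_den (PFun VoidB P)\<close> has exactly one element.
\<close>

datatype bval = VNat nat | VBool bool | VInt int | VUnit

datatype val = VBase bval | VFun "bval \<Rightarrow> val"

fun base_den :: "base \<Rightarrow> bval set" where
  "base_den NatB = range VNat"
| "base_den BoolB = range VBool"
| "base_den IntB = range VInt"
| "base_den UnitB = {VUnit}"
| "base_den VoidB = {}"

fun prim_den :: "prim \<Rightarrow> val set" where
  "prim_den (PBase b) = VBase ` base_den b"
| "prim_den (PFun b P) = VFun ` (base_den b \<rightarrow>\<^sub>E prim_den P)"

section \<open>Consistency, join, matching, precision\<close>

inductive consistent :: "ty \<Rightarrow> ty \<Rightarrow> bool"  (infix \<open>\<sim>\<close> 50) where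
  "A \<sim> \<star>"
| "\<star> \<sim> B"
| "Base b \<sim> Base b"
| "A \<sim> A' \<Longrightarrow> B \<sim> B' \<Longrightarrow> A \<rightarrow>\<^sub>t B \<sim> A' \<rightarrow>\<^sub>t B'"
| "A \<sim> A' \<Longrightarrow> B \<sim> B' \<Longrightarrow> A \<times>\<^sub>t B \<sim> A' \<times>\<^sub>t B'"
| "A \<sim> A' \<Longrightarrow> B \<sim> B' \<Longrightarrow> A +\<^sub>t B \<sim> A' +\<^sub>t B'"

text \<open>
  The join is meaningful on consistent types only; it is unspecified on inconsistent ones, and
  every use in the typing rules is guarded by a consistency premise.
\<close>

fun join :: "ty \<Rightarrow> ty \<Rightarrow> ty"  (infixl \<open>\<squnion>\<close> 60) where
  "A \<squnion> \<star> = A"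
| "\<star> \<squnion> B = B"
| "Base b \<squnion> Base b' = (if b = b' then Base b else undefined)"
| "(A \<rightarrow>\<^sub>t B) \<squnion> (A' \<rightarrow>\<^sub>t B') = (A \<squnion> A') \<rightarrow>\<^sub>t (B \<squnion> B')"
| "(A \<times>\<^sub>t B) \<squnion> (A' \<times>\<^sub>t B') = (A \<squnion> A') \<times>\<^sub>t (B \<squnion> B')"
| "(A +\<^sub>t B) \<squnion> (A' +\<^sub>t B') = (A \<squnion> A') +\<^sub>t (B \<squnion> B')"
| "_ \<squnion> _ = undefined"

text \<open>\<open>matches op A A1 A2\<close> is the matching judgment for \<open>op\<close> one of \<open>Fun\<close>, \<open>Prod\<close>, \<open>Sum\<close>.\<close>

definition matches :: "(ty \<Rightarrow> ty \<Rightarrow> ty) \<Rightarrow> ty \<Rightarrow> ty \<Rightarrow> ty \<Rightarrow> bool" where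
  "matches op A A1 A2 \<longleftrightarrow> A = op A1 A2 \<or> (A = \<star> \<and> A1 = \<star> \<and> A2 = \<star>)"

inductive ty_prec :: "ty \<Rightarrow> ty \<Rightarrow> bool"  (infix \<open>\<sqsubseteq>\<close> 50) where
  "\<star> \<sqsubseteq> A"
| "Base b \<sqsubseteq> Base b"
| "A \<sqsubseteq> A' \<Longrightarrow> B \<sqsubseteq> B' \<Longrightarrow> A \<rightarrow>\<^sub>t B \<sqsubseteq> A' \<rightarrow>\<^sub>t B'"
| "A \<sqsubseteq> A' \<Longrightarrow> B \<sqsubseteq> B' \<Longrightarrow> A \<times>\<^sub>t B \<sqsubseteq> A' \<times>\<^sub>t B'"
| "A \<sqsubseteq> A' \<Longrightarrow> B \<sqsubseteq> B' \<Longrightarrow> A +\<^sub>t B \<sqsubseteq> A' +\<^sub>t B'"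

text \<open>
  The context \<open>\<Gamma> \<cdot> A\<close> is the list \<open>A # \<Gamma>\<close>, so the de Bruijn index \<open>x\<close> refers to \<open>\<Gamma> ! x\<close>.
\<close>

type_synonym ctx = "ty list"

abbreviation ctx_prec :: "ctx \<Rightarrow> ctx \<Rightarrow> bool"  (infix \<open>\<sqsubseteq>\<^sup>*\<close> 50) where
  "\<Gamma> \<sqsubseteq>\<^sup>* \<Gamma>' \<equiv> list_all2 (\<sqsubseteq>) \<Gamma> \<Gamma>'"

section \<open>The gradually typed lambda calculus\<close>

text \<open>
  The type variable \<open>'l\<close> is the type of blame labels. In \<open>Case l B1 C1 L M N\<close>, index 0 is bound
  in \<open>M\<close> (at type \<open>B1\<close>) and in \<open>N\<close> (at type \<open>C1\<close>). A constant carries its primitive type, as its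
  value alone need not determine it: \<open>prim_den (PFun VoidB P)\<close> is the same set for all \<open>P\<close>.
\<close>

datatype 'l trm =
    Const val prim
  | Var nat
  | Lam ty "'l trm"
  | App "'l trm" "'l trm" 'l
  | If 'l "'l trm" "'l trm" "'l trm"
  | Cons "'l trm" "'l trm"
  | Fst 'l "'l trm"
  | Snd 'l "'l trm"
  | Inl ty "'l trm"
  | Inr ty "'l trm"
  | Case 'l ty ty "'l trm" "'l trm" "'l trm"

inductive typing :: "ctx \<Rightarrow> 'l trm \<Rightarrow> ty \<Rightarrow> bool"
    (\<open>_ \<turnstile>\<^sub>G _ : _\<close> [51, 51, 51] 50) where
  T_Const: "k \<in> prim_den P \<Longrightarrow> \<Gamma> \<turnstile>\<^sub>G Const k P : prim_ty P"
| T_Var: "x < length \<Gamma> \<Longrightarrow> \<Gamma> ! x = A \<Longrightarrow> \<Gamma> \<turnstile>\<^sub>G Var x : A"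
| T_Lam: "(A # \<Gamma>) \<turnstile>\<^sub>G M : B \<Longrightarrow> \<Gamma> \<turnstile>\<^sub>G Lam A M : A \<rightarrow>\<^sub>t B"
| T_App: "\<Gamma> \<turnstile>\<^sub>G L : A \<Longrightarrow> \<Gamma> \<turnstile>\<^sub>G M : B \<Longrightarrow> matches Fun A A1 A2 \<Longrightarrow> A1 \<sim> B
    \<Longrightarrow> \<Gamma> \<turnstile>\<^sub>G App L M l : A2"
| T_If: "\<Gamma> \<turnstile>\<^sub>G L : A \<Longrightarrow> \<Gamma> \<turnstile>\<^sub>G M : B \<Longrightarrow> \<Gamma> \<turnstile>\<^sub>G N : C \<Longrightarrow> A \<sim> Base BoolB \<Longrightarrow> B \<sim> C
    \<Longrightarrow> \<Gamma> \<turnstile>\<^sub>G If l L M N : B \<squnion> C"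
| T_Cons: "\<Gamma> \<turnstile>\<^sub>G M : A \<Longrightarrow> \<Gamma> \<turnstile>\<^sub>G N : B \<Longrightarrow> \<Gamma> \<turnstile>\<^sub>G Cons M N : A \<times>\<^sub>t B"
| T_Fst: "\<Gamma> \<turnstile>\<^sub>G M : A \<Longrightarrow> matches Prod A A1 A2 \<Longrightarrow> \<Gamma> \<turnstile>\<^sub>G Fst l M : A1"
| T_Snd: "\<Gamma> \<turnstile>\<^sub>G M : A \<Longrightarrow> matches Prod A A1 A2 \<Longrightarrow> \<Gamma> \<turnstile>\<^sub>G Snd l M : A2"
| T_Inl: "\<Gamma> \<turnstile>\<^sub>G M : A \<Longrightarrow> \<Gamma> \<turnstile>\<^sub>G Inl B M : A +\<^sub>t B"
| T_Inr: "\<Gamma> \<turnstile>\<^sub>G M : B \<Longrightarrow> \<Gamma> \<turnstile>\<^sub>G Inr A M : A +\<^sub>t B"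
| T_Case: "\<Gamma> \<turnstile>\<^sub>G L : A \<Longrightarrow> (B1 # \<Gamma>) \<turnstile>\<^sub>G M : B2 \<Longrightarrow> (C1 # \<Gamma>) \<turnstile>\<^sub>G N : C2
    \<Longrightarrow> A \<sim> B1 +\<^sub>t C1 \<Longrightarrow> B2 \<sim> C2 \<Longrightarrow> \<Gamma> \<turnstile>\<^sub>G Case l B1 C1 L M N : B2 \<squnion> C2"

inductive trm_prec :: "'l trm \<Rightarrow> 'l trm \<Rightarrow> bool"  (infix \<open>\<sqsubseteq>\<^sup>G\<close> 50) where
  "Const k P \<sqsubseteq>\<^sup>G Const k P"
| "Var x \<sqsubseteq>\<^sup>G Var x"
| "A \<sqsubseteq> A' \<Longrightarrow> M \<sqsubseteq>\<^sup>G M' \<Longrightarrow> Lam A M \<sqsubseteq>\<^sup>G Lam A' M'"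
| "L \<sqsubseteq>\<^sup>G L' \<Longrightarrow> M \<sqsubseteq>\<^sup>G M' \<Longrightarrow> App L M l \<sqsubseteq>\<^sup>G App L' M' l'"
| "L \<sqsubseteq>\<^sup>G L' \<Longrightarrow> M \<sqsubseteq>\<^sup>G M' \<Longrightarrow> N \<sqsubseteq>\<^sup>G N' \<Longrightarrow> If l L M N \<sqsubseteq>\<^sup>G If l' L' M' N'"
| "M \<sqsubseteq>\<^sup>G M' \<Longrightarrow> N \<sqsubseteq>\<^sup>G N' \<Longrightarrow> Cons M N \<sqsubseteq>\<^sup>G Cons M' N'"
| "M \<sqsubseteq>\<^sup>G M' \<Longrightarrow> Fst l M \<sqsubseteq>\<^sup>G Fst l' M'"
| "M \<sqsubseteq>\<^sup>G M' \<Longrightarrow> Snd l M \<sqsubseteq>\<^sup>G Snd l' M'"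
| "B \<sqsubseteq> B' \<Longrightarrow> M \<sqsubseteq>\<^sup>G M' \<Longrightarrow> Inl B M \<sqsubseteq>\<^sup>G Inl B' M'"
| "A \<sqsubseteq> A' \<Longrightarrow> M \<sqsubseteq>\<^sup>G M' \<Longrightarrow> Inr A M \<sqsubseteq>\<^sup>G Inr A' M'"
| "B1 \<sqsubseteq> B1' \<Longrightarrow> C1 \<sqsubseteq> C1' \<Longrightarrow> L \<sqsubseteq>\<^sup>G L' \<Longrightarrow> M \<sqsubseteq>\<^sup>G M' \<Longrightarrow> N \<sqsubseteq>\<^sup>G N'
    \<Longrightarrow> Case l B1 C1 L M N \<sqsubseteq>\<^sup>G Case l' B1' C1' L' M' N'"

end

theory Submission
  imports Defs
begin

text \<open>Losing precision means replacing parts of a type by \<star>, and every side condition of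
  the typing rules tolerates this. Consistency is closed downwards in both arguments
  (\<open>consistent_mono\<close>), join is monotone on consistent pairs (\<open>join_mono\<close>),
  and a matching of a type yields a less precise matching of any type below it
  (\<open>matches_Fun_mono\<close>, \<open>matches_Prod_mono\<close>). So a typing derivation for
  the more precise term can be replayed rule by rule on the less precise one: term precision forces
  the same outermost constructor, the induction hypotheses type the subterms at smaller types, and
  the monotonicity lemmas re-establish the premises and bound the resulting type.

  The inversion rules below fix the shape of the right-hand, more precise side, because that is
  where the induction analyses the derivation.\<close>

inductive_cases prec_UnknownE: "A \<sqsubseteq> \<star>"
inductive_cases prec_BaseE: "A \<sqsubseteq> Base b"
inductive_cases prec_FunE: "A \<sqsubseteq> B \<rightarrow>\<^sub>t C"
inductive_cases prec_ProdE: "A \<sqsubseteq> B \<times>\<^sub>t C"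
inductive_cases prec_SumE: "A \<sqsubseteq> B +\<^sub>t C"

lemmas prec_cases = prec_UnknownE prec_BaseE prec_FunE prec_ProdE prec_SumE

inductive_cases prec_ConstE: "M \<sqsubseteq>\<^sup>G Const k P"
inductive_cases prec_VarE: "M \<sqsubseteq>\<^sup>G Var x"
inductive_cases prec_LamE: "M \<sqsubseteq>\<^sup>G Lam A N"
inductive_cases prec_AppE: "M \<sqsubseteq>\<^sup>G App L N l"
inductive_cases prec_IfE: "M \<sqsubseteq>\<^sup>G If l L N K"
inductive_cases prec_ConsE: "M \<sqsubseteq>\<^sup>G Cons L N"
inductive_cases prec_FstE: "M \<sqsubseteq>\<^sup>G Fst l N"
inductive_cases prec_SndE: "M \<sqsubseteq>\<^sup>G Snd l N"
inductive_cases prec_InlE: "M \<sqsubseteq>\<^sup>G Inl B N"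
inductive_cases prec_InrE: "M \<sqsubseteq>\<^sup>G Inr A N"
inductive_cases prec_CaseE: "M \<sqsubseteq>\<^sup>G Case l B C L N K"

lemma ty_prec_refl: "A \<sqsubseteq> A"
  by (induction A) (auto intro: ty_prec.intros)

text \<open>The equations of \<open>join\<close> overlap at \<star>, so sequential pattern matching
  splits the second one by the constructor of \<open>B\<close>; this restores it as a single rewrite
  rule.\<close>

lemma join_Unknown_left [simp]: "\<star> \<squnion> B = B"
  by (cases B) auto

text \<open>A type below a compound type is either \<star>, which is consistent with everything, or
  has the same constructor with smaller components, where the induction hypotheses apply.\<close>

lemma consistent_mono:
  assumes "A' \<sim> B'" "A \<sqsubseteq> A'" "B \<sqsubseteq> B'"
  shows "A \<sim> B"
  using assms
  by (induction arbitrary: A B rule: consistent.induct)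
    (fastforce elim!: prec_cases intro: consistent.intros)+

text \<open>Consistency of the upper pair rules out the unspecified values of \<open>join\<close>,
  and inducting on it visits exactly the defining clauses. If an upper type is \<star>, so is the
  lower one, and both joins collapse to the other argument.\<close>

lemma join_mono:
  assumes "A' \<sim> B'" "A \<sqsubseteq> A'" "B \<sqsubseteq> B'"
  shows "A \<squnion> B \<sqsubseteq> A' \<squnion> B'"
  using assms
proof (induction arbitrary: A B rule: consistent.induct)
  case (4 A1 A1' B1 B1')
  \<comment> \<open>These bounds serve the case where just one of the lower types is \<star>: the
    join is then the other one, whose components must lie below the joined components. They are the
    induction hypotheses with \<star> as one lower argument.\<close>
  have "C \<sqsubseteq> A1 \<squnion> A1'" if "C \<sqsubseteq> A1 \<or> C \<sqsubseteq> A1'" for C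
    using that "4.IH"(1)[of C \<star>] "4.IH"(1)[of \<star> C] by (auto intro: ty_prec.intros)
  moreover have "C \<sqsubseteq> B1 \<squnion> B1'" if "C \<sqsubseteq> B1 \<or> C \<sqsubseteq> B1'" for C
    using that "4.IH"(2)[of C \<star>] "4.IH"(2)[of \<star> C] by (auto intro: ty_prec.intros)
  ultimately show ?case
    using "4.prems" by (auto elim!: prec_FunE intro!: ty_prec.intros "4.IH")
next
  case (5 A1 A1' B1 B1')
  have "C \<sqsubseteq> A1 \<squnion> A1'" if "C \<sqsubseteq> A1 \<or> C \<sqsubseteq> A1'" for C
    using that "5.IH"(1)[of C \<star>] "5.IH"(1)[of \<star> C] by (auto intro: ty_prec.intros)
  moreover have "C \<sqsubseteq> B1 \<squnion> B1'" if "C \<sqsubseteq> B1 \<or> C \<sqsubseteq> B1'" for C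
    using that "5.IH"(2)[of C \<star>] "5.IH"(2)[of \<star> C] by (auto intro: ty_prec.intros)
  ultimately show ?case
    using "5.prems" by (auto elim!: prec_ProdE intro!: ty_prec.intros "5.IH")
next
  case (6 A1 A1' B1 B1')
  have "C \<sqsubseteq> A1 \<squnion> A1'" if "C \<sqsubseteq> A1 \<or> C \<sqsubseteq> A1'" for C
    using that "6.IH"(1)[of C \<star>] "6.IH"(1)[of \<star> C] by (auto intro: ty_prec.intros)
  moreover have "C \<sqsubseteq> B1 \<squnion> B1'" if "C \<sqsubseteq> B1 \<or> C \<sqsubseteq> B1'" for C
    using that "6.IH"(2)[of C \<star>] "6.IH"(2)[of \<star> C] by (auto intro: ty_prec.intros)
  ultimately show ?case
    using "6.prems" by (auto elim!: prec_SumE intro!: ty_prec.intros "6.IH")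
qed (auto elim!: prec_UnknownE prec_BaseE intro: ty_prec.intros)

text \<open>Below a function type lies either a function type, matched by its own components, or
  \<star>, matched by \<star> twice; below \<star> lies only \<star>.\<close>

lemma matches_Fun_mono:
  assumes "matches Fun A' A1' A2'" "A \<sqsubseteq> A'"
  obtains A1 A2 where "matches Fun A A1 A2" "A1 \<sqsubseteq> A1'" "A2 \<sqsubseteq> A2'"
  using assms by (auto simp: matches_def elim!: prec_FunE prec_UnknownE intro: ty_prec.intros)

lemma matches_Prod_mono:
  assumes "matches Prod A' A1' A2'" "A \<sqsubseteq> A'"
  obtains A1 A2 where "matches Prod A A1 A2" "A1 \<sqsubseteq> A1'" "A2 \<sqsubseteq> A2'"
  using assms by (auto simp: matches_def elim!: prec_ProdE prec_UnknownE intro: ty_prec.intros)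

theorem theorem2:
  fixes \<Gamma> \<Gamma>' :: ctx and M M' :: "'l trm" and A' :: ty
  assumes "\<Gamma>' \<turnstile>\<^sub>G M' : A'"
    and "\<Gamma> \<sqsubseteq>\<^sup>* \<Gamma>'"
    and "M \<sqsubseteq>\<^sup>G M'"
  shows "\<exists>A. \<Gamma> \<turnstile>\<^sub>G M : A \<and> A \<sqsubseteq> A'"
  using assms
\<comment> \<open>The lower context must vary, since binders extend it by their own, less precise
  annotations.\<close>
proof (induction arbitrary: \<Gamma> M rule: typing.induct)
  case T_Const
  then show ?case by (blast elim: prec_ConstE intro: typing.intros ty_prec_refl)
next
  case T_Var
  then show ?case
    by (auto elim!: prec_VarE intro!: typing.intros simp: list_all2_conv_all_nth)
next
  case (T_Lam A' \<Gamma>' M' B')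
  from \<open>M \<sqsubseteq>\<^sup>G Lam A' M'\<close> obtain A N where M: "M = Lam A N" "A \<sqsubseteq> A'" "N \<sqsubseteq>\<^sup>G M'"
    by (rule prec_LamE)
  with T_Lam.IH[of "A # \<Gamma>" N] T_Lam.prems show ?case
    by (auto intro: typing.intros ty_prec.intros)
next
  case (T_App \<Gamma>' L' A' M' B' A1' A2' l')
  from \<open>M \<sqsubseteq>\<^sup>G App L' M' l'\<close> obtain L N l
    where M: "M = App L N l" "L \<sqsubseteq>\<^sup>G L'" "N \<sqsubseteq>\<^sup>G M'"
    by (rule prec_AppE)
  obtain A where A: "\<Gamma> \<turnstile>\<^sub>G L : A" "A \<sqsubseteq> A'"
    using T_App.IH(1) T_App.prems M by blast
  obtain B where B: "\<Gamma> \<turnstile>\<^sub>G N : B" "B \<sqsubseteq> B'"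
    using T_App.IH(2) T_App.prems M by blast
  obtain A1 A2 where "matches Fun A A1 A2" "A1 \<sqsubseteq> A1'" "A2 \<sqsubseteq> A2'"
    using matches_Fun_mono T_App.hyps(3) A(2) by blast
  then show ?case
    using M(1) A B consistent_mono[OF \<open>A1' \<sim> B'\<close>] by (blast intro: typing.intros)
next
  case (T_If \<Gamma>' L' A' M' B' N' C' l')
  from \<open>M \<sqsubseteq>\<^sup>G If l' L' M' N'\<close> obtain l L K N
    where M: "M = If l L K N" "L \<sqsubseteq>\<^sup>G L'" "K \<sqsubseteq>\<^sup>G M'" "N \<sqsubseteq>\<^sup>G N'"
    by (rule prec_IfE)
  obtain A where A: "\<Gamma> \<turnstile>\<^sub>G L : A" "A \<sqsubseteq> A'"
    using T_If.IH(1) T_If.prems M by blast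
  obtain B where B: "\<Gamma> \<turnstile>\<^sub>G K : B" "B \<sqsubseteq> B'"
    using T_If.IH(2) T_If.prems M by blast
  obtain C where C: "\<Gamma> \<turnstile>\<^sub>G N : C" "C \<sqsubseteq> C'"
    using T_If.IH(3) T_If.prems M by blast
  \<comment> \<open>The Boolean side stays fixed, so reflexivity of precision supplies its premise
    in \<open>consistent_mono\<close>.\<close>
  have "A \<sim> Base BoolB" "B \<sim> C"
    using T_If.hyps A B C ty_prec_refl consistent_mono by blast+
  then have "\<Gamma> \<turnstile>\<^sub>G M : B \<squnion> C"
    using M(1) A B C by (blast intro: typing.intros)
  then show ?case
    using join_mono[OF \<open>B' \<sim> C'\<close>] B C by blast
next
  case (T_Case \<Gamma>' L' A' B1' M' B2' C1' N' C2' l')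
  from \<open>M \<sqsubseteq>\<^sup>G Case l' B1' C1' L' M' N'\<close> obtain l B1 C1 L K N
    where M: "M = Case l B1 C1 L K N" "B1 \<sqsubseteq> B1'" "C1 \<sqsubseteq> C1'"
      "L \<sqsubseteq>\<^sup>G L'" "K \<sqsubseteq>\<^sup>G M'" "N \<sqsubseteq>\<^sup>G N'"
    by (rule prec_CaseE)
  obtain A where A: "\<Gamma> \<turnstile>\<^sub>G L : A" "A \<sqsubseteq> A'"
    using T_Case.IH(1) T_Case.prems M by blast
  obtain B2 where B: "(B1 # \<Gamma>) \<turnstile>\<^sub>G K : B2" "B2 \<sqsubseteq> B2'"
    using T_Case.IH(2)[of "B1 # \<Gamma>" K] T_Case.prems M by auto
  obtain C2 where C: "(C1 # \<Gamma>) \<turnstile>\<^sub>G N : C2" "C2 \<sqsubseteq> C2'"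
    using T_Case.IH(3)[of "C1 # \<Gamma>" N] T_Case.prems M by auto
  \<comment> \<open>Here both sides lose precision: the scrutinee type by induction, the sum through
    its annotations.\<close>
  have "A \<sim> B1 +\<^sub>t C1" "B2 \<sim> C2"
    using T_Case.hyps A B C M consistent_mono ty_prec.intros(5) by blast+
  then have "\<Gamma> \<turnstile>\<^sub>G M : B2 \<squnion> C2"
    using M(1) A B C by (blast intro: typing.intros)
  then show ?case
    using join_mono[OF \<open>B2' \<sim> C2'\<close>] B C by blast
next
  case T_Cons
  then show ?case by (blast elim: prec_ConsE intro: typing.intros ty_prec.intros)
next
  case (T_Fst \<Gamma>' M' A' A1' A2' l')
  from \<open>M \<sqsubseteq>\<^sup>G Fst l' M'\<close> obtain l N where M: "M = Fst l N" "N \<sqsubseteq>\<^sup>G M'"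
    by (rule prec_FstE)
  obtain A where A: "\<Gamma> \<turnstile>\<^sub>G N : A" "A \<sqsubseteq> A'"
    using T_Fst.IH T_Fst.prems M by blast
  then obtain A1 A2 where "matches Prod A A1 A2" "A1 \<sqsubseteq> A1'" "A2 \<sqsubseteq> A2'"
    using matches_Prod_mono T_Fst.hyps(2) by blast
  then show ?case
    using M(1) A by (blast intro: typing.intros)
next
  case (T_Snd \<Gamma>' M' A' A1' A2' l')
  from \<open>M \<sqsubseteq>\<^sup>G Snd l' M'\<close> obtain l N where M: "M = Snd l N" "N \<sqsubseteq>\<^sup>G M'"
    by (rule prec_SndE)
  obtain A where A: "\<Gamma> \<turnstile>\<^sub>G N : A" "A \<sqsubseteq> A'"
    using T_Snd.IH T_Snd.prems M by blast
  then obtain A1 A2 where "matches Prod A A1 A2" "A1 \<sqsubseteq> A1'" "A2 \<sqsubseteq> A2'"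
    using matches_Prod_mono T_Snd.hyps(2) by blast
  then show ?case
    using M(1) A by (blast intro: typing.intros)
next
  case T_Inl
  then show ?case by (blast elim: prec_InlE intro: typing.intros ty_prec.intros)
next
  case T_Inr
  then show ?case by (blast elim: prec_InrE intro: typing.intros ty_prec.intros)
qed

end
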